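(* Let $q=p^h$ with $p$ an odd prime and $h\ge1$, let $d=q-1$, and define $\phi_q\in\mathbb R^{\mathbb F_q^\times}$ by $$\phi_q(1)=\frac{1+\sqrt d}{\sqrt{2d+2\sqrt d}},\qquad\phi_q(m)=\frac1{\sqrt{2d+2\sqrt d}}\quad(m\ne1).$$ Then $$\|\mathcal M_{\phi_q}(A)\|_{\ell^2(G_q)}\ge\frac{\sqrt q}{\sqrt d+1}\,\sin\!\Big(\frac{\pi}{2p}\Big)\|A\|_F\qquad(A\in\mathbb C^{\mathbb F_q^\times\times\mathbb F_q^\times}).$$ In particular, the inverse of $\mathcal M_{\phi_q}$ on its range has norm at most $2p$; hence, for each fixed odd characteristic $p$, this produces a uniformly stable (in $h$) deterministic matrix-recovery orbit in every dimension $d=p^h-1$. If $h\ge2$, then $$\sigma_{\min}(\mathcal M_{\phi_q})=\frac{\sqrt q}{\sqrt d+1}\,\sin\!\Big(\frac{\pi}{2p}\Big).$$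
   Context: $G_q=\mathbb F_q\rtimes\mathbb F_q^\times$ is the affine group with product $(k,l)(k',l')=(k+lk',ll')$, acting on $\mathbb C^{\mathbb F_q^\times}$ by the unitary representation $(\pi_q(k,l)f)(m)=\psi(km)f(lm)$, where $\psi$ is any fixed nontrivial additive character of $\mathbb F_q$. For a vector $\phi$, $\mathcal M_\phi:\mathbb C^{\mathbb F_q^\times\times\mathbb F_q^\times}\to\mathbb C^{G_q}$ is the linear map $\mathcal M_\phi(A)(g)=\langle A\pi_q(g)\phi,\pi_q(g)\phi\rangle$, and $\sigma_{\min}(\mathcal M_\phi)=\min_{A\ne0}\|\mathcal M_\phi(A)\|_{\ell^2(G_q)}/\|A\|_F$ (Frobenius norm; counting measure on $G_q$). The orbit of $\phi$ does matrix recovery if the rank-one operators $(\pi_q(g)\phi)(\pi_q(g)\phi)^*$, $g\in G_q$, span $\mathbb C^{d\times d}$, equivalently $\mathcal M_\phi$ is injective. *)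

theory Defs
  imports Complex_Main "HOL-Algebra.Ring" "HOL-Computational_Algebra.Primes"
begin

(* The space of complex functions on a set X (vectors, matrices, data) is rendered as the set of
   functions that vanish outside X, so that equality of functions is equality on X. *)
definition cfuns :: "'b set \<Rightarrow> ('b \<Rightarrow> complex) set" where
  "cfuns X = {f. \<forall>x. x \<notin> X \<longrightarrow> f x = 0}"

definition l2_norm :: "'b set \<Rightarrow> ('b \<Rightarrow> complex) \<Rightarrow> real" where
  "l2_norm X f = sqrt (\<Sum>x\<in>X. (cmod (f x))\<^sup>2)"

definition c_inner :: "'b set \<Rightarrow> ('b \<Rightarrow> complex) \<Rightarrow> ('b \<Rightarrow> complex) \<Rightarrow> complex" where
  "c_inner X u v = (\<Sum>x\<in>X. u x * cnj (v x))"

definition affine_group :: "('a, 'm) ring_scheme \<Rightarrow> ('a \<times> 'a) monoid" where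
  "affine_group F =
    \<lparr>carrier = carrier F \<times> Units F,
     monoid.mult = (\<lambda>(k, l) (k', l'). (k \<oplus>\<^bsub>F\<^esub> l \<otimes>\<^bsub>F\<^esub> k', l \<otimes>\<^bsub>F\<^esub> l')),
     one = (\<zero>\<^bsub>F\<^esub>, \<one>\<^bsub>F\<^esub>)\<rparr>"

definition additive_character :: "('a, 'm) ring_scheme \<Rightarrow> ('a \<Rightarrow> complex) \<Rightarrow> bool" where
  "additive_character F \<psi> \<longleftrightarrow>
    (\<forall>x\<in>carrier F. cmod (\<psi> x) = 1) \<and>
    (\<forall>x\<in>carrier F. \<forall>y\<in>carrier F. \<psi> (x \<oplus>\<^bsub>F\<^esub> y) = \<psi> x * \<psi> y)"

definition nontrivial_additive_character :: "('a, 'm) ring_scheme \<Rightarrow> ('a \<Rightarrow> complex) \<Rightarrow> bool" where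
  "nontrivial_additive_character F \<psi> \<longleftrightarrow>
    additive_character F \<psi> \<and> (\<exists>x\<in>carrier F. \<psi> x \<noteq> 1)"

definition affine_rep ::
  "('a, 'm) ring_scheme \<Rightarrow> ('a \<Rightarrow> complex) \<Rightarrow> 'a \<times> 'a \<Rightarrow> ('a \<Rightarrow> complex) \<Rightarrow> 'a \<Rightarrow> complex" where
  "affine_rep F \<psi> g f m =
    (case g of (k, l) \<Rightarrow>
      if m \<in> Units F then \<psi> (k \<otimes>\<^bsub>F\<^esub> m) * f (l \<otimes>\<^bsub>F\<^esub> m) else 0)"

definition matrices :: "('a, 'm) ring_scheme \<Rightarrow> ('a \<times> 'a \<Rightarrow> complex) set" where
  "matrices F = cfuns (Units F \<times> Units F)"

abbreviation frobenius_norm :: "('a, 'm) ring_scheme \<Rightarrow> ('a \<times> 'a \<Rightarrow> complex) \<Rightarrow> real" where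
  "frobenius_norm F A \<equiv> l2_norm (Units F \<times> Units F) A"

definition mat_apply ::
  "('a, 'm) ring_scheme \<Rightarrow> ('a \<times> 'a \<Rightarrow> complex) \<Rightarrow> ('a \<Rightarrow> complex) \<Rightarrow> 'a \<Rightarrow> complex" where
  "mat_apply F A f m = (if m \<in> Units F then \<Sum>n\<in>Units F. A (m, n) * f n else 0)"

definition measurement ::
  "('a, 'm) ring_scheme \<Rightarrow> ('a \<Rightarrow> complex) \<Rightarrow> ('a \<Rightarrow> complex) \<Rightarrow>
    ('a \<times> 'a \<Rightarrow> complex) \<Rightarrow> 'a \<times> 'a \<Rightarrow> complex" where
  "measurement F \<psi> \<phi> A g =
    (if g \<in> carrier (affine_group F)
     then c_inner (Units F) (mat_apply F A (affine_rep F \<psi> g \<phi>)) (affine_rep F \<psi> g \<phi>)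
     else 0)"

abbreviation data_norm :: "('a, 'm) ring_scheme \<Rightarrow> ('a \<times> 'a \<Rightarrow> complex) \<Rightarrow> real" where
  "data_norm F y \<equiv> l2_norm (carrier (affine_group F)) y"

definition sigma_min ::
  "('a, 'm) ring_scheme \<Rightarrow> ('a \<Rightarrow> complex) \<Rightarrow> ('a \<Rightarrow> complex) \<Rightarrow> real" where
  "sigma_min F \<psi> \<phi> =
    (LEAST s. \<exists>A\<in>matrices F. A \<noteq> (\<lambda>_. 0) \<and>
       s = data_norm F (measurement F \<psi> \<phi> A) / frobenius_norm F A)"

definition rank_one :: "('a \<Rightarrow> complex) \<Rightarrow> 'a \<times> 'a \<Rightarrow> complex" where
  "rank_one v = (\<lambda>(m, n). v m * cnj (v n))"

(* The left-hand side is the complex linear span of the rank-one operators along the orbit. *)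
definition matrix_recovery ::
  "('a, 'm) ring_scheme \<Rightarrow> ('a \<Rightarrow> complex) \<Rightarrow> ('a \<Rightarrow> complex) \<Rightarrow> bool" where
  "matrix_recovery F \<psi> \<phi> \<longleftrightarrow>
    {(\<lambda>x. \<Sum>g\<in>carrier (affine_group F). c g * rank_one (affine_rep F \<psi> g \<phi>) x) | c. True}
      = matrices F"

definition phi :: "('a, 'm) ring_scheme \<Rightarrow> 'a \<Rightarrow> complex" where
  "phi F m =
    (let d = real (card (carrier F)) - 1 in
     if m \<notin> Units F then 0
     else if m = \<one>\<^bsub>F\<^esub> then complex_of_real ((1 + sqrt d) / sqrt (2 * d + 2 * sqrt d))
     else complex_of_real (1 / sqrt (2 * d + 2 * sqrt d)))"

end

theory Submission
  imports Defs "HOL-Algebra.Multiplicative_Group"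
begin

text \<open>Write \<open>s = sqrt d\<close>. By Parseval in the translation variable, the squared norm of the data is
  \<open>q\<close> times the sum of the contributions of the shifted diagonals \<open>a u = A (u, u + t)\<close>. For
  \<open>t \<noteq> 0\<close> the shape of the vector makes the contribution at the dilation \<open>1 / u\<close> equal to
  \<open>(S / s + a u + a (u - t)) / (2 (s + 1))\<close> with \<open>S\<close> the sum of \<open>a\<close>; since \<open>a u + a (u - t)\<close> sums to
  \<open>2 S\<close>, the term \<open>S / s\<close> only adds energy. What remains is the operator \<open>1 + shift\<close>, which the
  Fourier transform diagonalises with eigenvalues \<open>1 + z\<close>, \<open>z ^ p = 1\<close>, and for odd \<open>p\<close> these have
  modulus at least \<open>2 sin (pi / (2 p))\<close>. The main diagonal satisfies a stronger bound. For \<open>h \<ge> 2\<close>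
  there is an extremal eigenvector that avoids \<open>0\<close> and has \<open>S = 0\<close>, so the bound is attained.\<close>

section \<open>Roots of unity of odd order and the sine bound\<close>

lemma cmod_one_plus_cis: "cmod (1 + cis x) = 2 * \<bar>cos (x / 2)\<bar>"
proof -
  have "(cmod (1 + cis x))\<^sup>2 = (1 + cos x)\<^sup>2 + (sin x)\<^sup>2"
    by (simp add: cmod_def)
  also have "\<dots> = 1 + 2 * cos x + ((cos x)\<^sup>2 + (sin x)\<^sup>2)"
    by (simp add: power2_eq_square algebra_simps)
  also have "\<dots> = 2 + 2 * cos (2 * (x / 2))"
    by simp
  also have "\<dots> = (2 * \<bar>cos (x / 2)\<bar>)\<^sup>2"
    unfolding cos_double_cos by (simp add: power_mult_distrib)
  finally show ?thesis
    by (rule power2_eq_imp_eq) auto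
qed

text \<open>If \<open>z = cis (2 pi j / p)\<close> then \<open>|1 + z|\<close> is twice
  \<open>|cos (pi j / p)|\<close>, the sine of the distance from \<open>pi j / p\<close> to
  \<open>pi / 2\<close>. As \<open>p\<close> is odd, \<open>p - 2 j\<close> is a nonzero integer, so
  this distance is at least \<open>pi / (2 p)\<close>.\<close>

lemma cmod_one_plus_odd_root_ge:
  assumes "odd p" and "z ^ p = 1"
  shows "2 * sin (pi / (2 * real p)) \<le> cmod (1 + z)"
proof -
  have p: "p > 0" using assms(1) by (cases p) auto
  obtain j where j: "j < p" and z: "z = cis (2 * pi * real j / real p)"
    using bij_betw_roots_unity[OF p] assms(2) unfolding bij_betw_def by blast
  define x where "x = pi * (real p - 2 * real j) / (2 * real p)"
  have ne: "int p - 2 * int j \<noteq> 0" using assms(1) by presburger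
  hence "\<bar>int p - 2 * int j\<bar> \<ge> 1" by linarith
  hence "real_of_int \<bar>int p - 2 * int j\<bar> \<ge> 1" by linarith
  hence ge: "\<bar>real p - 2 * real j\<bar> \<ge> 1" by simp
  have le: "\<bar>real p - 2 * real j\<bar> \<le> real p" using j by auto
  have ax: "\<bar>x\<bar> = pi * \<bar>real p - 2 * real j\<bar> / (2 * real p)"
    unfolding x_def by (simp add: abs_mult)
  have "pi / (2 * real p) \<le> \<bar>x\<bar>"
    unfolding ax using ge p by (simp add: divide_right_mono)
  moreover have "\<bar>x\<bar> \<le> pi / 2"
    unfolding ax using le p by (simp add: field_simps)
  moreover have "- (pi / 2) \<le> pi / (2 * real p)"
    by (rule order_trans[of _ 0]) auto
  ultimately have "sin (pi / (2 * real p)) \<le> sin \<bar>x\<bar>"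
    by (intro sin_monotone_2pi_le) auto
  also have "sin \<bar>x\<bar> \<le> \<bar>sin x\<bar>" by (cases "x \<ge> 0") auto
  also have "sin x = cos (pi / 2 - x)" by (simp add: cos_sin_eq)
  also have "pi / 2 - x = pi * real j / real p"
    unfolding x_def using p by (simp add: field_simps)
  finally show ?thesis
    unfolding z cmod_one_plus_cis by simp
qed

text \<open>Equality occurs at a root nearest to -1, with exponent
  \<open>r = (p - 1) / 2\<close>.\<close>

lemma exists_odd_root_attaining:
  assumes "odd p"
  obtains z where "z ^ p = 1" and "cmod (1 + z) = 2 * sin (pi / (2 * real p))"
proof -
  obtain r where r: "p = 2 * r + 1" using assms by (auto elim: oddE)
  let ?z = "cis (2 * pi * real r / real p)"
  have 1: "?z ^ p = 1"
    using bij_betw_roots_unity[of p] r by (auto simp: bij_betw_def)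
  have "2 * pi * real r / real p / 2 = pi / 2 - pi / (2 * real p)"
    using r by (simp add: field_simps)
  hence "cos (2 * pi * real r / real p / 2) = sin (pi / (2 * real p))"
    by (simp add: cos_diff)
  moreover have "sin (pi / (2 * real p)) \<ge> 0"
    using r by (intro sin_ge_zero) (auto simp: field_simps)
  ultimately have "cmod (1 + ?z) = 2 * sin (pi / (2 * real p))"
    unfolding cmod_one_plus_cis by simp
  with 1 show ?thesis by (rule that)
qed

text \<open>Write \<open>z\<close> as the \<open>j\<close>-th power of a primitive root;
  \<open>p\<close> being prime, \<open>j\<close> is invertible mod \<open>p\<close>. This serves to
  realise a prescribed root of unity as a value of \<open>\<psi>\<close>.\<close>

lemma root_of_unity_prime_generates:
  fixes z w :: complex
  assumes p: "prime p" and z: "z ^ p = 1" "z \<noteq> 1" and w: "w ^ p = 1"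
  obtains i :: nat where "z ^ i = w"
proof -
  have p0: "p > 0" using p prime_gt_0_nat by blast
  define \<omega> where "\<omega> = cis (2 * pi / real p)"
  have pow: "\<omega> ^ k = cis (2 * pi * real k / real p)" for k
    by (simp add: \<omega>_def DeMoivre mult.commute)
  have \<omega>p: "\<omega> ^ p = 1" using p0 by (simp add: pow)
  have "\<exists>k<p. v = \<omega> ^ k" if "v ^ p = 1" for v
    using bij_betw_roots_unity[OF p0] that unfolding bij_betw_def pow by blast
  then obtain j m where j: "j < p" "z = \<omega> ^ j" and m: "w = \<omega> ^ m"
    using z w by metis
  have j0: "j \<noteq> 0" using z j by (metis power_0)
  have "\<not> p dvd j" using j j0 by (auto dest: dvd_imp_le)
  hence "gcd j p = 1"
    using p prime_imp_coprime coprime_commute coprime_iff_gcd_eq_1 by blast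
  then obtain x y where "j * x = p * y + 1"
    using bezout_nat[OF j0, of p] by auto
  hence "z ^ (x * m) = (\<omega> ^ (p * y + 1)) ^ m"
    unfolding j by (metis power_mult)
  also have "\<dots> = w" unfolding m by (simp add: power_add power_mult \<omega>p)
  finally show ?thesis by (rule that)
qed

text \<open>Jordan's inequality at \<open>x = pi / (2 n)\<close>. The cubic Taylor bound gives
  \<open>sin x >= 5 x / 6\<close> for \<open>0 < x <= 1\<close>, and already \<open>2 x / 3\<close>
  is at least \<open>1 / n\<close> because \<open>pi >= 3\<close>.\<close>

lemma sin_pi_over_2n_ge:
  assumes "n \<ge> (2::nat)"
  shows "1 / real n \<le> sin (pi / (2 * real n))"
proof -
  define x where "x = pi / (2 * real n)"
  have x0: "x > 0" using assms by (simp add: x_def)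
  have x1: "x \<le> 1"
    using assms pi_less_4 by (simp add: x_def divide_simps)
  have "\<bar>sin x - (\<Sum>m<3. sin_coeff m * x ^ m)\<bar> \<le> inverse (fact 3) * \<bar>x\<bar> ^ 3"
    by (rule Maclaurin_sin_bound)
  hence "\<bar>sin x - x\<bar> \<le> x ^ 3 / 6"
    using x0 by (simp add: eval_nat_numeral sin_coeff_def)
  hence "sin x \<ge> x - x ^ 3 / 6" by linarith
  moreover have "x * x\<^sup>2 \<le> x * 1"
    using x0 x1 by (intro mult_left_mono) (auto simp: power2_eq_square mult_le_one)
  ultimately have "sin x \<ge> x * (5 / 6)"
    by (simp add: power3_eq_cube power2_eq_square)
  \<comment> \<open>From \<open>sin (pi / 6) = 1 / 2\<close> and \<open>sin x <= x\<close>.\<close>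
  moreover have "pi \<ge> 3"
    using sin_x_le_x[of "pi / 6"] by (simp add: sin_30)
  hence "x * (2 / 3) \<ge> 1 / real n"
    using assms by (simp add: x_def divide_simps)
  moreover have "x * (2 / 3) \<le> x * (5 / 6)" using x0 by simp
  ultimately show ?thesis unfolding x_def by linarith
qed

section \<open>Finite sums, orthogonal projection and norms\<close>

lemma sum_cmod_affine_shift:
  fixes b :: "'b \<Rightarrow> complex"
  shows "(\<Sum>u\<in>U. (cmod (x + b u))\<^sup>2) =
    real (card U) * (cmod x)\<^sup>2 + 2 * Re (cnj x * (\<Sum>u\<in>U. b u)) + (\<Sum>u\<in>U. (cmod (b u))\<^sup>2)"
proof -
  have "(cmod (x + b u))\<^sup>2 = (cmod x)\<^sup>2 + Re (2 * cnj x * b u) + (cmod (b u))\<^sup>2" for u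
    unfolding cmod_power2 by (simp add: power2_eq_square algebra_simps)
  then show ?thesis
    by (simp only: sum.distrib sum_constant Re_sum[symmetric] sum_distrib_left[symmetric])
       (simp add: algebra_simps)
qed

text \<open>Orthogonal projection onto the span of a possibly dependent family, by Gram-Schmidt: the
  residual \<open>z\<close> of \<open>w\<close> modulo the old vectors is corrected by a multiple of
  the residual \<open>y\<close> of the new vector \<open>v a\<close>.\<close>

lemma exists_orthogonal_residual:
  fixes v :: "'g \<Rightarrow> 'b \<Rightarrow> complex"
  assumes "finite G" and X: "finite X"
  shows "\<exists>c. \<forall>h\<in>G. c_inner X (\<lambda>x. w x - (\<Sum>g\<in>G. c g * v g x)) (v h) = 0"
  using assms(1)
proof (induction G arbitrary: w rule: finite_induct)
  case empty
  show ?case by simp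
next
  case (insert a G)
  let ?r = "\<lambda>f c x. f x - (\<Sum>g\<in>G. c g * v g x)"
  obtain c where c: "\<forall>h\<in>G. c_inner X (?r w c) (v h) = 0" using insert.IH by blast
  obtain e where e: "\<forall>h\<in>G. c_inner X (?r (v a) e) (v h) = 0" using insert.IH by blast
  define y where "y = ?r (v a) e"
  define z where "z = ?r w c"
  have lin: "c_inner X (\<lambda>x. f x - \<alpha> * g x) u = c_inner X f u - \<alpha> * c_inner X g u" for f g u \<alpha>
    by (simp add: c_inner_def algebra_simps sum_subtractf sum_distrib_left)
  have linr: "c_inner X f (\<lambda>x. g x - (\<Sum>h\<in>G. k h * v h x)) =
      c_inner X f g - (\<Sum>h\<in>G. cnj (k h) * c_inner X f (v h))" for f g k
    unfolding c_inner_def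
    by (simp add: algebra_simps sum_subtractf sum_distrib_left cnj_sum sum.swap[of _ G X])
  \<comment> \<open>\<open>y\<close> differs from \<open>v a\<close> by a combination of old
    vectors, which such an \<open>f\<close> does not see.\<close>
  have ya: "c_inner X f y = c_inner X f (v a)" if "\<forall>h\<in>G. c_inner X f (v h) = 0" for f
    unfolding y_def linr using that by simp
  \<comment> \<open>The value 0 covers a new vector that on \<open>X\<close> lies in the span of the
    old ones: then \<open>y\<close> vanishes on \<open>X\<close>, and \<open>z\<close> is already
    orthogonal to \<open>v a\<close>.\<close>
  define \<alpha> where "\<alpha> = (if c_inner X y (v a) = 0 then 0 else c_inner X z (v a) / c_inner X y (v a))"
  have zero: "c_inner X z (v a) = 0" if "c_inner X y (v a) = 0"
  proof -
    have "c_inner X y y = 0" using ya[of y] e that by (simp add: y_def)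
    hence "(\<Sum>x\<in>X. of_real ((cmod (y x))\<^sup>2)) = (0::complex)"
      unfolding c_inner_def complex_norm_square .
    hence "of_real (\<Sum>x\<in>X. (cmod (y x))\<^sup>2) = (0::complex)" by simp
    hence "(\<Sum>x\<in>X. (cmod (y x))\<^sup>2) = 0" by (simp only: of_real_eq_0_iff)
    hence "\<forall>x\<in>X. y x = 0" using X by (simp add: sum_nonneg_eq_0_iff)
    hence "c_inner X z y = 0" by (simp add: c_inner_def)
    thus ?thesis using ya[of z] c by (simp add: z_def)
  qed
  have a: "c_inner X (\<lambda>x. z x - \<alpha> * y x) (v a) = 0"
    unfolding lin by (simp add: \<alpha>_def zero)
  have h: "c_inner X (\<lambda>x. z x - \<alpha> * y x) (v h) = 0" if "h \<in> G" for h
    unfolding lin using c e that by (simp add: y_def z_def)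
  \<comment> \<open>The coefficients of \<open>w - (z - \<alpha> * y)\<close> in terms of the
    vectors \<open>v g\<close>.\<close>
  define k where "k g = (if g = a then \<alpha> else c g - \<alpha> * e g)" for g
  have k: "(\<Sum>g\<in>insert a G. k g * v g x) =
      \<alpha> * v a x + (\<Sum>g\<in>G. c g * v g x) - \<alpha> * (\<Sum>g\<in>G. e g * v g x)" for x
  proof -
    have "(\<Sum>g\<in>G. k g * v g x) = (\<Sum>g\<in>G. (c g - \<alpha> * e g) * v g x)"
      using insert.hyps by (intro sum.cong) (auto simp: k_def)
    thus ?thesis using insert.hyps
      by (simp add: k_def algebra_simps sum_subtractf sum_distrib_left)
  qed
  have "(\<lambda>x. w x - (\<Sum>g\<in>insert a G. k g * v g x)) = (\<lambda>x. z x - \<alpha> * y x)"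
    unfolding k by (simp add: y_def z_def algebra_simps)
  with a h show ?case by (intro exI[of _ k]) auto
qed

lemma l2_norm_nonneg: "l2_norm X f \<ge> 0"
  by (simp add: l2_norm_def sum_nonneg)

lemma l2_norm_le_0D:
  assumes "finite X" "l2_norm X f \<le> 0" "f \<in> cfuns X"
  shows "f = (\<lambda>_. 0)"
proof -
  have "(\<Sum>x\<in>X. (cmod (f x))\<^sup>2) \<le> 0" using assms(2) by (simp add: l2_norm_def)
  hence "(\<Sum>x\<in>X. (cmod (f x))\<^sup>2) = 0" by (intro antisym sum_nonneg) auto
  hence "\<forall>x\<in>X. f x = 0" using assms(1) by (simp add: sum_nonneg_eq_0_iff)
  thus ?thesis using assms(3) by (auto simp: cfuns_def)
qed

section \<open>Finite fields with a nontrivial additive character\<close>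

locale field_with_character = field F for F (structure) +
  fixes \<psi> :: "'a \<Rightarrow> complex"
  assumes fin: "finite (carrier F)"
    and nontrivial: "nontrivial_additive_character F \<psi>"
begin

abbreviation "q \<equiv> card (carrier F)"

lemma fin_Units: "finite (Units F)"
  using fin by (rule finite_subset[rotated]) auto

lemma card_Units: "card (Units F) = q - 1"
  using fin by (simp add: field_Units)

lemma card_carrier_ge_2: "q \<ge> 2"
proof -
  have "card {\<zero>, \<one>} \<le> q" by (intro card_mono fin) auto
  thus ?thesis by simp
qed

lemma psi_add: "x \<in> carrier F \<Longrightarrow> y \<in> carrier F \<Longrightarrow> \<psi> (x \<oplus> y) = \<psi> x * \<psi> y"
  and cmod_psi: "x \<in> carrier F \<Longrightarrow> cmod (\<psi> x) = 1"
  using nontrivial by (auto simp: nontrivial_additive_character_def additive_character_def)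

lemma psi_zero: "\<psi> \<zero> = 1"
proof -
  have "\<psi> \<zero> = \<psi> \<zero> * \<psi> \<zero>" using psi_add[of \<zero> \<zero>] by simp
  moreover have "\<psi> \<zero> \<noteq> 0" using cmod_psi[of \<zero>] by auto
  ultimately show ?thesis by simp
qed

lemma psi_diff:
  assumes "x \<in> carrier F" "y \<in> carrier F"
  shows "\<psi> (x \<ominus> y) = \<psi> x * cnj (\<psi> y)"
proof -
  have "\<psi> y * cnj (\<psi> y) = 1"
    using complex_norm_square[of "\<psi> y"] cmod_psi[OF assms(2)] by simp
  moreover have "\<psi> (x \<ominus> y) * \<psi> y = \<psi> x"
    using psi_add[of "x \<ominus> y" y] assms by (simp add: a_minus_def a_assoc l_neg)
  ultimately show ?thesis by (metis mult.assoc mult.right_neutral)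
qed

lemma psi_mult_diff:
  assumes "k \<in> carrier F" "x \<in> carrier F" "y \<in> carrier F"
  shows "\<psi> (k \<otimes> (x \<ominus> y)) = \<psi> (k \<otimes> x) * cnj (\<psi> (k \<otimes> y))"
proof -
  have "k \<otimes> (x \<ominus> y) = k \<otimes> x \<ominus> k \<otimes> y" using assms by algebra
  thus ?thesis using assms by (simp add: psi_diff)
qed

lemma psi_add_pow: "x \<in> carrier F \<Longrightarrow> \<psi> ([(n::nat)] \<cdot> x) = \<psi> x ^ n"
  by (induction n) (simp_all add: psi_zero psi_add)

lemma sum_carrier_shift:
  assumes "x \<in> carrier F"
  shows "(\<Sum>t\<in>carrier F. f (t \<oplus> x)) = (\<Sum>t\<in>carrier F. f t)"
  using assms
  by (intro sum.reindex_bij_witness[of _ "\<lambda>t. t \<ominus> x" "\<lambda>t. t \<oplus> x"])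
     (auto simp: a_minus_def a_assoc l_neg r_neg)

lemma sum_carrier_shift':
  assumes "x \<in> carrier F"
  shows "(\<Sum>t\<in>carrier F. f (t \<ominus> x)) = (\<Sum>t\<in>carrier F. f t)"
  using sum_carrier_shift[of "\<ominus> x" f] assms by (simp add: a_minus_def)

lemma sum_carrier_shift_left:
  assumes "x \<in> carrier F"
  shows "(\<Sum>t\<in>carrier F. f (x \<oplus> t)) = (\<Sum>t\<in>carrier F. f t)"
  unfolding sum_carrier_shift[OF assms, of f, symmetric]
  using assms by (intro sum.cong) (auto simp: a_comm)

lemma sum_Units_inv: "(\<Sum>l\<in>Units F. f (inv l)) = (\<Sum>l\<in>Units F. f l)"
  by (intro sum.reindex_bij_witness[of _ "\<lambda>l. inv l" "\<lambda>l. inv l"]) auto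

text \<open>Orthogonality of characters: for nonzero \<open>t\<close>, translating \<open>k\<close>
  by the \<open>y\<close> with \<open>y t = x\<close> multiplies the sum by \<open>\<psi> x\<close>,
  which is not 1.\<close>

lemma sum_psi:
  assumes t: "t \<in> carrier F"
  shows "(\<Sum>k\<in>carrier F. \<psi> (k \<otimes> t)) = (if t = \<zero> then of_nat q else 0)"
proof (cases "t = \<zero>")
  case True
  thus ?thesis by (simp add: psi_zero)
next
  case False
  obtain x where x: "x \<in> carrier F" "\<psi> x \<noteq> 1"
    using nontrivial by (auto simp: nontrivial_additive_character_def)
  have tU: "t \<in> Units F" using False t by (simp add: field_Units)
  define y where "y = x \<otimes> inv t"
  have y: "y \<in> carrier F" "y \<otimes> t = x"
    using x t tU by (auto simp: y_def m_assoc)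
  have "(\<Sum>k\<in>carrier F. \<psi> (k \<otimes> t)) = (\<Sum>k\<in>carrier F. \<psi> ((k \<oplus> y) \<otimes> t))"
    by (rule sum_carrier_shift[OF y(1), symmetric])
  also have "\<dots> = \<psi> x * (\<Sum>k\<in>carrier F. \<psi> (k \<otimes> t))"
    using t y x by (simp add: l_distr psi_add sum_distrib_left mult.commute)
  finally show ?thesis using x False by simp
qed

text \<open>Expanding the square leaves \<open>\<psi> (k (t - s))\<close> summed over
  \<open>k\<close>, and by \<open>sum_psi\<close> only \<open>s = t\<close> survives, with weight
  \<open>q\<close>.\<close>

lemma parseval:
  "(\<Sum>k\<in>carrier F. (cmod (\<Sum>t\<in>carrier F. w t * \<psi> (k \<otimes> t)))\<^sup>2) =
    real q * (\<Sum>t\<in>carrier F. (cmod (w t))\<^sup>2)"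
proof -
  let ?C = "carrier F"
  have "(\<Sum>k\<in>?C. complex_of_real ((cmod (\<Sum>t\<in>?C. w t * \<psi> (k \<otimes> t)))\<^sup>2)) =
      (\<Sum>k\<in>?C. \<Sum>t\<in>?C. \<Sum>s\<in>?C. w t * cnj (w s) * \<psi> (k \<otimes> (t \<ominus> s)))"
    unfolding complex_norm_square
    by (intro sum.cong refl)
       (simp add: cnj_sum sum_product psi_mult_diff mult.assoc mult.left_commute cong: sum.cong)
  also have "\<dots> = (\<Sum>t\<in>?C. \<Sum>s\<in>?C. w t * cnj (w s) * (\<Sum>k\<in>?C. \<psi> (k \<otimes> (t \<ominus> s))))"
    by (subst sum.swap, rule sum.cong[OF refl], subst sum.swap) (simp add: sum_distrib_left)
  also have "\<dots> = (\<Sum>t\<in>?C. \<Sum>s\<in>?C. if s = t then of_nat q * (w t * cnj (w t)) else 0)"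
    by (intro sum.cong refl) (auto simp: sum_psi)
  also have "\<dots> = of_nat q * (\<Sum>t\<in>?C. w t * cnj (w t))"
    using fin by (simp add: sum_distrib_left)
  also have "\<dots> = complex_of_real (real q * (\<Sum>t\<in>?C. (cmod (w t))\<^sup>2))"
    by (simp only: complex_norm_square[symmetric]) simp
  finally show ?thesis
    by (simp only: of_real_sum[symmetric] of_real_eq_iff)
qed

section \<open>Fourier analysis of the measurements along shifted diagonals\<close>

text \<open>The \<open>t\<close>-th Fourier coefficient of the data in the translation variable, at
  fixed dilation \<open>l\<close>. The sum runs over the whole carrier so that translations act on
  it; for \<open>A\<close> in \<open>matrices F\<close> the added entries are zero.\<close>

definition diag_corr :: "('a \<times> 'a \<Rightarrow> complex) \<Rightarrow> ('a \<Rightarrow> complex) \<Rightarrow> 'a \<Rightarrow> 'a \<Rightarrow> complex" where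
  "diag_corr A \<phi> l t =
    (\<Sum>m\<in>carrier F. A (m, m \<oplus> t) * \<phi> (l \<otimes> (m \<oplus> t)) * cnj (\<phi> (l \<otimes> m)))"

lemma measurement_eq:
  assumes A: "A \<in> matrices F" and k: "k \<in> carrier F" and l: "l \<in> Units F"
  shows "measurement F \<psi> \<phi> A (k, l) = (\<Sum>t\<in>carrier F. diag_corr A \<phi> l t * \<psi> (k \<otimes> t))"
proof -
  let ?C = "carrier F" and ?U = "Units F"
  have A0: "A (m, n) = 0" if "m \<notin> ?U \<or> n \<notin> ?U" for m n
    using A that by (auto simp: matrices_def cfuns_def)
  let ?g = "\<lambda>m n. A (m, n) * \<phi> (l \<otimes> n) * cnj (\<phi> (l \<otimes> m)) * \<psi> (k \<otimes> (n \<ominus> m))"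
  have "measurement F \<psi> \<phi> A (k, l) = (\<Sum>m\<in>?U. \<Sum>n\<in>?U. ?g m n)"
    using k l unfolding measurement_def affine_group_def c_inner_def
    by (simp add: mat_apply_def affine_rep_def sum_distrib_right, intro sum.cong refl)
       (simp add: psi_mult_diff Units_closed)
  \<comment> \<open>\<open>A\<close> vanishes off the units, so both sums extend to the carrier,
    where the substitution \<open>n = m + t\<close> is a bijection.\<close>
  also have "\<dots> = (\<Sum>m\<in>?U. \<Sum>n\<in>?C. ?g m n)"
    by (intro sum.cong refl sum.mono_neutral_left fin) (auto simp: A0)
  also have "\<dots> = (\<Sum>m\<in>?C. \<Sum>n\<in>?C. ?g m n)"
    by (intro sum.mono_neutral_left fin) (auto simp: A0)
  also have "\<dots> = (\<Sum>m\<in>?C. \<Sum>t\<in>?C. ?g m (m \<oplus> t))"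
  proof (rule sum.cong[OF refl])
    fix m assume "m \<in> ?C"
    from sum_carrier_shift_left[OF this, of "?g m"]
    show "(\<Sum>n\<in>?C. ?g m n) = (\<Sum>t\<in>?C. ?g m (m \<oplus> t))" by (rule sym)
  qed
  also have "\<dots> = (\<Sum>m\<in>?C. \<Sum>t\<in>?C. A (m, m \<oplus> t) * \<phi> (l \<otimes> (m \<oplus> t)) * cnj (\<phi> (l \<otimes> m)) * \<psi> (k \<otimes> t))"
  proof (intro sum.cong refl)
    fix m t assume "m \<in> ?C" "t \<in> ?C"
    hence "m \<oplus> t \<ominus> m = t" by algebra
    thus "?g m (m \<oplus> t) = A (m, m \<oplus> t) * \<phi> (l \<otimes> (m \<oplus> t)) * cnj (\<phi> (l \<otimes> m)) * \<psi> (k \<otimes> t)"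
      by simp
  qed
  also have "\<dots> = (\<Sum>t\<in>?C. diag_corr A \<phi> l t * \<psi> (k \<otimes> t))"
    unfolding diag_corr_def sum_distrib_right by (rule sum.swap)
  finally show ?thesis .
qed

text \<open>Parseval in \<open>k\<close> at each dilation, followed by the substitution
  \<open>l = inv u\<close>, which for the vector \<open>phi\<close> puts the peak of the dilated
  vector at the index \<open>u\<close>.\<close>

lemma data_norm_measurement:
  assumes A: "A \<in> matrices F"
  shows "(data_norm F (measurement F \<psi> \<phi> A))\<^sup>2 =
    real q * (\<Sum>t\<in>carrier F. \<Sum>u\<in>Units F. (cmod (diag_corr A \<phi> (inv u) t))\<^sup>2)"
proof -
  let ?C = "carrier F" and ?U = "Units F"
  have "(data_norm F (measurement F \<psi> \<phi> A))\<^sup>2 =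
      (\<Sum>x\<in>?C \<times> ?U. (cmod (measurement F \<psi> \<phi> A x))\<^sup>2)"
    by (simp add: l2_norm_def affine_group_def sum_nonneg)
  also have "\<dots> = (\<Sum>k\<in>?C. \<Sum>l\<in>?U. (cmod (measurement F \<psi> \<phi> A (k, l)))\<^sup>2)"
    by (simp add: sum.cartesian_product)
  also have "\<dots> = (\<Sum>l\<in>?U. \<Sum>k\<in>?C. (cmod (measurement F \<psi> \<phi> A (k, l)))\<^sup>2)"
    by (rule sum.swap)
  also have "\<dots> = (\<Sum>l\<in>?U. real q * (\<Sum>t\<in>?C. (cmod (diag_corr A \<phi> l t))\<^sup>2))"
    by (intro sum.cong refl) (simp add: measurement_eq[OF A] parseval)
  also have "\<dots> = (\<Sum>u\<in>?U. real q * (\<Sum>t\<in>?C. (cmod (diag_corr A \<phi> (inv u) t))\<^sup>2))"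
    by (rule sum_Units_inv[symmetric])
  also have "\<dots> = real q * (\<Sum>t\<in>?C. \<Sum>u\<in>?U. (cmod (diag_corr A \<phi> (inv u) t))\<^sup>2)"
    by (subst sum.swap) (simp add: sum_distrib_left)
  finally show ?thesis .
qed

lemma frobenius_norm_eq:
  assumes A: "A \<in> matrices F"
  shows "(frobenius_norm F A)\<^sup>2 = (\<Sum>t\<in>carrier F. \<Sum>u\<in>carrier F. (cmod (A (u, u \<oplus> t)))\<^sup>2)"
proof -
  let ?C = "carrier F" and ?U = "Units F"
  have A0: "A x = 0" if "x \<notin> ?U \<times> ?U" for x
    using A that unfolding matrices_def cfuns_def by blast
  have "(frobenius_norm F A)\<^sup>2 = (\<Sum>x\<in>?U \<times> ?U. (cmod (A x))\<^sup>2)"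
    by (simp add: l2_norm_def sum_nonneg)
  also have "\<dots> = (\<Sum>x\<in>?C \<times> ?C. (cmod (A x))\<^sup>2)"
    by (intro sum.mono_neutral_left) (use fin A0 in auto)
  also have "\<dots> = (\<Sum>m\<in>?C. \<Sum>n\<in>?C. (cmod (A (m, n)))\<^sup>2)"
    by (simp add: sum.cartesian_product)
  also have "\<dots> = (\<Sum>m\<in>?C. \<Sum>t\<in>?C. (cmod (A (m, m \<oplus> t)))\<^sup>2)"
  proof (rule sum.cong[OF refl])
    fix m assume "m \<in> ?C"
    from sum_carrier_shift_left[OF this, of "\<lambda>n. (cmod (A (m, n)))\<^sup>2"]
    show "(\<Sum>n\<in>?C. (cmod (A (m, n)))\<^sup>2) = (\<Sum>t\<in>?C. (cmod (A (m, m \<oplus> t)))\<^sup>2)"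
      by (rule sym)
  qed
  finally show ?thesis by (subst (asm) sum.swap)
qed

text \<open>The Fourier transform turns \<open>a u + a (u - t)\<close> into multiplication by
  \<open>1 + \<psi> (k t)\<close>. Each factor is \<open>1 + z\<close> with
  \<open>z ^ p = 1\<close>, so the bound on roots holds frequency by frequency, and Parseval on both
  sides transfers it.\<close>

lemma sum_cmod_shift_ge:
  assumes "odd p" and root: "\<And>x. x \<in> carrier F \<Longrightarrow> \<psi> x ^ p = 1" and t: "t \<in> carrier F"
  shows "(2 * sin (pi / (2 * real p)))\<^sup>2 * (\<Sum>u\<in>carrier F. (cmod (a u))\<^sup>2) \<le>
    (\<Sum>u\<in>carrier F. (cmod (a u + a (u \<ominus> t)))\<^sup>2)"
proof -
  let ?C = "carrier F" and ?\<sigma> = "2 * sin (pi / (2 * real p))"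
  let ?fa = "\<lambda>k. \<Sum>u\<in>?C. a u * \<psi> (k \<otimes> u)"
  have \<sigma>0: "?\<sigma> \<ge> 0"
    using \<open>odd p\<close> by (cases p) (auto intro!: sin_ge_zero simp: field_simps)
  have hat: "(\<Sum>u\<in>?C. (a u + a (u \<ominus> t)) * \<psi> (k \<otimes> u)) = ?fa k * (1 + \<psi> (k \<otimes> t))" if k: "k \<in> ?C" for k
  proof -
    have "(\<Sum>u\<in>?C. a (u \<ominus> t) * \<psi> (k \<otimes> u)) = (\<Sum>u\<in>?C. a (u \<oplus> t \<ominus> t) * \<psi> (k \<otimes> (u \<oplus> t)))"
      by (rule sum_carrier_shift[OF t, symmetric])
    also have "\<dots> = (\<Sum>u\<in>?C. a u * \<psi> (k \<otimes> u) * \<psi> (k \<otimes> t))"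
      using t k by (intro sum.cong refl) (simp add: a_minus_def a_assoc r_neg r_distr psi_add)
    finally show ?thesis by (simp add: algebra_simps sum.distrib sum_distrib_left)
  qed
  have "real q * (?\<sigma>\<^sup>2 * (\<Sum>u\<in>?C. (cmod (a u))\<^sup>2)) = (\<Sum>k\<in>?C. (cmod (?fa k))\<^sup>2 * ?\<sigma>\<^sup>2)"
    using parseval[of a] by (simp add: sum_distrib_right[symmetric])
  also have "\<dots> \<le> (\<Sum>k\<in>?C. (cmod (?fa k * (1 + \<psi> (k \<otimes> t))))\<^sup>2)"
    unfolding norm_mult[of "?fa _"] power_mult_distrib[of "cmod (?fa _)"]
  proof (intro sum_mono mult_left_mono power_mono \<sigma>0)
    fix k assume "k \<in> ?C"
    thus "?\<sigma> \<le> cmod (1 + \<psi> (k \<otimes> t))"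
      using t by (intro cmod_one_plus_odd_root_ge \<open>odd p\<close> root) simp
  qed simp
  also have "\<dots> = (\<Sum>k\<in>?C. (cmod (\<Sum>u\<in>?C. (a u + a (u \<ominus> t)) * \<psi> (k \<otimes> u)))\<^sup>2)"
    by (simp add: hat)
  also have "\<dots> = real q * (\<Sum>u\<in>?C. (cmod (a u + a (u \<ominus> t)))\<^sup>2)"
    by (rule parseval)
  finally show ?thesis using card_carrier_ge_2 by simp
qed

section \<open>Contributions of the shifted diagonals for the vector \<open>phi\<close>\<close>

definition s :: real where
  "s = sqrt (real q - 1)"

lemma s_ge_1: "s \<ge> 1"
  using card_carrier_ge_2 by (simp add: s_def)

lemma s_squared: "s\<^sup>2 = real q - 1"
  using card_carrier_ge_2 by (simp add: s_def)

text \<open>Trades one factor \<open>s\<close> of the normalisation for the quotient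
  \<open>X / s\<close>, the form in which \<open>sum_Units_affine\<close> takes the diagonal
  formulas.\<close>

lemma rescale_by_s:
  "complex_of_real (1 / (2 * s * (s + 1))) * (X + of_real s * Y) =
    of_real (1 / (2 * (s + 1))) * (X / of_real s + Y)"
proof -
  have X: "X + of_real s * Y = of_real s * (X / of_real s + Y)"
    using s_ge_1 by (simp add: distrib_left)
  have "1 / (2 * (s + 1)) = 1 / (2 * s * (s + 1)) * s"
    using s_ge_1 by simp
  thus ?thesis unfolding X by (simp only: of_real_mult mult.assoc)
qed

lemma matrices_eq_0: "A \<in> matrices F \<Longrightarrow> m \<notin> Units F \<or> n \<notin> Units F \<Longrightarrow> A (m, n) = 0"
  by (auto simp: matrices_def cfuns_def)

text \<open>Dilation by \<open>inv u\<close> moves the peak from 1 to \<open>u\<close>, and with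
  \<open>d = s^2\<close> the radicand becomes \<open>2 s (s + 1)\<close>.\<close>

lemma phi_inv_mult:
  assumes u: "u \<in> Units F" and m: "m \<in> Units F"
  shows "phi F (inv u \<otimes> m) =
    complex_of_real (1 / sqrt (2 * s * (s + 1))) * (1 + (if m = u then of_real s else 0))"
proof -
  have "m = u \<longleftrightarrow> inv u \<otimes> m = \<one>"
    using u m Units_l_cancel[of "inv u" m u] by auto
  moreover have "2 * (real q - 1) + 2 * s = 2 * s * (s + 1)"
    unfolding s_squared[symmetric] by (simp add: algebra_simps power2_eq_square)
  ultimately show ?thesis
    using u m unfolding phi_def Let_def s_def[symmetric] by (simp add: add_divide_distrib)
qed

lemma phi_product_inv_mult:
  assumes "u \<in> Units F" "m \<in> Units F" "n \<in> Units F"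
  shows "phi F (inv u \<otimes> n) * cnj (phi F (inv u \<otimes> m)) =
    of_real (1 / (2 * s * (s + 1))) *
      ((1 + (if n = u then of_real s else 0)) * (1 + (if m = u then of_real s else 0)))"
proof -
  define e where "e = 2 * s * (s + 1)"
  have e: "e \<ge> 0" using s_ge_1 by (simp add: e_def)
  have "(if P then of_real s else 0) = complex_of_real (if P then s else 0)" for P by simp
  moreover have "complex_of_real (1 / sqrt e) * of_real (1 / sqrt e) = of_real (1 / e)"
    using e by (simp flip: of_real_mult)
  ultimately show ?thesis
    unfolding phi_inv_mult[OF assms(1,2)] phi_inv_mult[OF assms(1,3)] e_def[symmetric]
    by (simp add: mult.assoc mult.left_commute del: of_real_divide)
qed

text \<open>With \<open>n = m + t\<close>, the product of the two peaked factors expands into a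
  constant, a peak at \<open>m = u\<close> and a peak at \<open>m = u - t\<close>.\<close>

lemma diag_corr_phi:
  assumes A: "A \<in> matrices F" and t: "t \<in> carrier F" "t \<noteq> \<zero>" and u: "u \<in> Units F"
  shows "diag_corr A (phi F) (inv u) t = of_real (1 / (2 * (s + 1))) *
    ((\<Sum>m\<in>carrier F. A (m, m \<oplus> t)) / of_real s + (A (u, u \<oplus> t) + A (u \<ominus> t, u)))"
proof -
  let ?C = "carrier F" and ?S = "complex_of_real s"
  define c where "c = complex_of_real (1 / (2 * s * (s + 1)))"
  have uC: "u \<in> ?C" using u by auto
  have "diag_corr A (phi F) (inv u) t =
    (\<Sum>m\<in>?C. c * (A (m, m \<oplus> t) + (if m = u then ?S * A (m, m \<oplus> t) else 0)
       + (if m = u \<ominus> t then ?S * A (m, m \<oplus> t) else 0)))"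
    unfolding diag_corr_def
  proof (intro sum.cong refl)
    fix m assume m: "m \<in> ?C"
    show "A (m, m \<oplus> t) * phi F (inv u \<otimes> (m \<oplus> t)) * cnj (phi F (inv u \<otimes> m)) =
      c * (A (m, m \<oplus> t) + (if m = u then ?S * A (m, m \<oplus> t) else 0)
       + (if m = u \<ominus> t then ?S * A (m, m \<oplus> t) else 0))"
    proof (cases "m \<in> Units F \<and> m \<oplus> t \<in> Units F")
      case False
      hence "A (m, m \<oplus> t) = 0" using A by (simp add: matrices_eq_0)
      thus ?thesis by auto
    next
      case True
      have 1: "m \<oplus> t = u \<longleftrightarrow> m = u \<ominus> t" using m t uC by (auto simp: a_minus_def a_assoc l_neg r_neg)
      \<comment> \<open>As \<open>t\<close> is nonzero the two peaks sit at different
        \<open>m\<close>, so the product term \<open>s^2\<close> never occurs.\<close>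
      have 2: "u \<noteq> u \<ominus> t"
      proof
        assume "u = u \<ominus> t"
        hence "u \<oplus> t = u \<ominus> t \<oplus> t" by simp
        hence "u \<oplus> t = u" using t uC by (simp add: a_minus_def a_assoc l_neg)
        thus False using t uC add.l_cancel_one[of u t] by simp
      qed
      show ?thesis
        unfolding mult.assoc using True u 1 2 by (simp add: phi_product_inv_mult[folded c_def])
          (simp add: algebra_simps)
    qed
  qed
  also have "\<dots> = c * ((\<Sum>m\<in>?C. A (m, m \<oplus> t)) + ?S * A (u, u \<oplus> t) + ?S * A (u \<ominus> t, u \<ominus> t \<oplus> t))"
    unfolding sum_distrib_left[symmetric]
    using fin uC t by (simp add: sum.distrib sum.delta minus_closed)
  also have "u \<ominus> t \<oplus> t = u" using t uC by (simp add: a_minus_def a_assoc l_neg)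
  finally show ?thesis
    unfolding c_def add.assoc distrib_left[of ?S, symmetric] rescale_by_s .
qed

text \<open>Here both peaks fall on \<open>m = u\<close>; the weight
  \<open>(1 + s)^2 = 1 + s (s + 2)\<close> produces the coefficient \<open>s + 2\<close>.\<close>

lemma diag_corr_phi_diagonal:
  assumes A: "A \<in> matrices F" and u: "u \<in> Units F"
  shows "diag_corr A (phi F) (inv u) \<zero> = of_real (1 / (2 * (s + 1))) *
    ((\<Sum>m\<in>carrier F. A (m, m)) / of_real s + of_real (s + 2) * A (u, u))"
proof -
  let ?C = "carrier F" and ?S = "complex_of_real s"
  define c where "c = complex_of_real (1 / (2 * s * (s + 1)))"
  have uC: "u \<in> ?C" using u by auto
  have "diag_corr A (phi F) (inv u) \<zero> =
    (\<Sum>m\<in>?C. c * (A (m, m) + (if m = u then ?S * (?S + 2) * A (m, m) else 0)))"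
    unfolding diag_corr_def
  proof (intro sum.cong refl)
    fix m assume m: "m \<in> ?C"
    show "A (m, m \<oplus> \<zero>) * phi F (inv u \<otimes> (m \<oplus> \<zero>)) * cnj (phi F (inv u \<otimes> m)) =
      c * (A (m, m) + (if m = u then ?S * (?S + 2) * A (m, m) else 0))"
    proof (cases "m \<in> Units F")
      case False
      hence "m \<noteq> u" using u by auto
      thus ?thesis using False m A by (simp add: matrices_eq_0)
    next
      case True
      thus ?thesis using m u unfolding mult.assoc
        by (simp add: phi_product_inv_mult[folded c_def])
          (simp add: algebra_simps)
    qed
  qed
  also have "\<dots> = c * ((\<Sum>m\<in>?C. A (m, m)) + ?S * (?S + 2) * A (u, u))"
    unfolding sum_distrib_left[symmetric] using fin uC by (simp add: sum.distrib sum.delta)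
  finally show ?thesis
    unfolding c_def mult.assoc[of ?S] rescale_by_s by simp
qed

text \<open>For \<open>r \<ge> 0\<close> the perturbation \<open>S / s\<close> can only increase the norm.\<close>

lemma sum_Units_affine:
  fixes S :: complex
  assumes b: "(\<Sum>u\<in>Units F. b u) = of_real r * S"
  shows "(\<Sum>u\<in>Units F. (cmod (of_real c * (S / of_real s + b u)))\<^sup>2) =
    c\<^sup>2 * ((1 + 2 * r / s) * (cmod S)\<^sup>2 + (\<Sum>u\<in>Units F. (cmod (b u))\<^sup>2))"
proof -
  have card: "real (card (Units F)) = s\<^sup>2"
    using card_carrier_ge_2 by (simp add: card_Units s_squared)
  have "cnj (S / of_real s) * (of_real r * S) = of_real (r / s * (cmod S)\<^sup>2)"
    using complex_norm_square[of S] by (simp add: field_simps)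
  hence cross: "Re (cnj (S / of_real s) * (of_real r * S)) = r / s * (cmod S)\<^sup>2"
    by (simp only: Re_complex_of_real)
  \<comment> \<open>There are \<open>s^2\<close> units, which exactly compensates the division of
    \<open>S\<close> by \<open>s\<close>.\<close>
  have square: "s\<^sup>2 * (cmod (S / of_real s))\<^sup>2 = (cmod S)\<^sup>2"
    using s_ge_1 by (simp add: norm_divide power_divide)
  have "(\<Sum>u\<in>Units F. (cmod (S / of_real s + b u))\<^sup>2) =
      (1 + 2 * r / s) * (cmod S)\<^sup>2 + (\<Sum>u\<in>Units F. (cmod (b u))\<^sup>2)"
    unfolding sum_cmod_affine_shift card b cross square by (simp add: algebra_simps)
  thus ?thesis by (simp add: norm_mult power_mult_distrib sum_distrib_left[symmetric])
qed

lemma sum_Units_eq_carrier: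
  assumes "f \<zero> = 0"
  shows "(\<Sum>u\<in>Units F. f u) = (\<Sum>u\<in>carrier F. f u)"
  using assms fin by (intro sum.mono_neutral_left) (auto simp: field_Units)

text \<open>This is \<open>sum_Units_affine\<close> with \<open>r = 2\<close>, since each entry of
  the diagonal occurs in two of the terms \<open>A (u, u + t) + A (u - t, u)\<close>; hence
  \<open>1 + 4 / s\<close>. Being an identity, it serves both the lower bound and the extremal
  case.\<close>

lemma sum_diag_corr_phi:
  assumes A: "A \<in> matrices F" and t: "t \<in> carrier F" "t \<noteq> \<zero>"
  shows "(\<Sum>u\<in>Units F. (cmod (diag_corr A (phi F) (inv u) t))\<^sup>2) = (1 / (2 * (s + 1)))\<^sup>2 *
    ((1 + 4 / s) * (cmod (\<Sum>u\<in>carrier F. A (u, u \<oplus> t)))\<^sup>2 +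
      (\<Sum>u\<in>carrier F. (cmod (A (u, u \<oplus> t) + A (u \<ominus> t, u)))\<^sup>2))"
proof -
  let ?C = "carrier F"
  let ?S = "\<Sum>u\<in>?C. A (u, u \<oplus> t)" and ?b = "\<lambda>u. A (u, u \<oplus> t) + A (u \<ominus> t, u)"
  have 0: "\<zero> \<notin> Units F" by (simp add: field_Units)
  have "(\<Sum>u\<in>?C. A (u \<ominus> t, u)) = (\<Sum>u\<in>?C. A (u \<ominus> t, u \<ominus> t \<oplus> t))"
    using t by (intro sum.cong refl) (simp add: a_minus_def a_assoc l_neg)
  also have "\<dots> = ?S"
    by (rule sum_carrier_shift'[OF t(1), of "\<lambda>u. A (u, u \<oplus> t)"])
  finally have b: "(\<Sum>u\<in>Units F. ?b u) = of_real 2 * ?S"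
    using A 0 by (simp add: sum_Units_eq_carrier matrices_eq_0 sum.distrib)
  show ?thesis
    using A 0 sum_Units_affine[OF b, of "1 / (2 * (s + 1))"]
    by (simp add: diag_corr_phi[OF A t] sum_Units_eq_carrier[of "\<lambda>u. (cmod (?b u))\<^sup>2"]
        matrices_eq_0 del: of_real_divide)
qed

text \<open>Apply \<open>sum_Units_affine\<close> with \<open>r = s + 2\<close>, drop the
  nonnegative term in the trace and weaken \<open>(s + 2)^2\<close> to 4, which cancels the 2 in the
  normalisation.\<close>

lemma sum_diag_corr_phi_diagonal_ge:
  assumes A: "A \<in> matrices F"
  shows "(\<Sum>u\<in>carrier F. (cmod (A (u, u)))\<^sup>2) \<le>
    (s + 1)\<^sup>2 * (\<Sum>u\<in>Units F. (cmod (diag_corr A (phi F) (inv u) \<zero>))\<^sup>2)"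
proof -
  let ?C = "carrier F"
  let ?S = "\<Sum>u\<in>?C. A (u, u)" and ?N = "\<Sum>u\<in>?C. (cmod (A (u, u)))\<^sup>2"
  have 0: "\<zero> \<notin> Units F" by (simp add: field_Units)
  have b: "(\<Sum>u\<in>Units F. of_real (s + 2) * A (u, u)) = of_real (s + 2) * ?S"
    unfolding sum_distrib_left using A 0 by (simp add: sum_Units_eq_carrier matrices_eq_0)
  have "(\<Sum>u\<in>Units F. (cmod (of_real (s + 2) * A (u, u)))\<^sup>2) = (s + 2)\<^sup>2 * ?N"
    unfolding norm_mult power_mult_distrib norm_of_real power2_abs sum_distrib_left
    using A 0 by (simp add: sum_Units_eq_carrier matrices_eq_0)
  hence eq: "(\<Sum>u\<in>Units F. (cmod (diag_corr A (phi F) (inv u) \<zero>))\<^sup>2) =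
      (1 / (2 * (s + 1)))\<^sup>2 * ((1 + 2 * (s + 2) / s) * (cmod ?S)\<^sup>2 + (s + 2)\<^sup>2 * ?N)"
    using sum_Units_affine[OF b, of "1 / (2 * (s + 1))"]
    by (simp add: diag_corr_phi_diagonal[OF A] del: of_real_divide)
  have N0: "?N \<ge> 0" by (simp add: sum_nonneg)
  have "4 \<le> (s + 2)\<^sup>2" using s_ge_1 power_mono[of 2 "s + 2" 2] by simp
  hence "4 * ?N \<le> (s + 2)\<^sup>2 * ?N" using N0 by (rule mult_right_mono)
  also have "\<dots> \<le> (1 + 2 * (s + 2) / s) * (cmod ?S)\<^sup>2 + (s + 2)\<^sup>2 * ?N"
    using s_ge_1 by simp
  also have "\<dots> = 4 * ((s + 1)\<^sup>2 * (\<Sum>u\<in>Units F. (cmod (diag_corr A (phi F) (inv u) \<zero>))\<^sup>2))"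
    unfolding eq using s_ge_1 by (simp only: power_divide power_mult_distrib) (simp add: field_simps)
  finally show ?thesis by simp
qed

section \<open>From injectivity to matrix recovery\<close>

lemma finite_affine_group: "finite (carrier (affine_group F))"
  using fin fin_Units by (simp add: affine_group_def)

text \<open>The data are Frobenius inner products with the rank-one operators of the orbit, so
  injectivity says that no nonzero matrix is orthogonal to all of them.\<close>

lemma measurement_eq_c_inner:
  assumes "g \<in> carrier (affine_group F)"
  shows "measurement F \<psi> \<phi> A g =
    c_inner (Units F \<times> Units F) A (rank_one (affine_rep F \<psi> g \<phi>))"
  using assms
  unfolding measurement_def c_inner_def sum.cartesian_product[symmetric] sum.cartesian_product'
  by (simp add: mat_apply_def rank_one_def sum_distrib_right sum_distrib_left mult_ac)

lemma measurement_diff: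
  "measurement F \<psi> \<phi> (\<lambda>x. A x - B x) g = measurement F \<psi> \<phi> A g - measurement F \<psi> \<phi> B g"
proof (cases "g \<in> carrier (affine_group F)")
  case True
  show ?thesis unfolding measurement_eq_c_inner[OF True]
    by (simp add: c_inner_def left_diff_distrib sum_subtractf)
qed (simp add: measurement_def)

lemma rank_one_affine_rep_in_matrices: "rank_one (affine_rep F \<psi> g \<phi>) \<in> matrices F"
  by (cases g) (auto simp: matrices_def cfuns_def rank_one_def affine_rep_def)

text \<open>The residual of \<open>A\<close> after projection onto the span of the orbit operators
  has zero data, so injectivity makes it vanish and \<open>A\<close> lies in the span.\<close>

lemma measurement_injective_imp_recovery:
  assumes inj: "\<And>B. B \<in> matrices F \<Longrightarrow> measurement F \<psi> \<phi> B = (\<lambda>_. 0) \<Longrightarrow> B = (\<lambda>_. 0)"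
  shows "matrix_recovery F \<psi> \<phi>"
proof -
  let ?G = "carrier (affine_group F)" and ?v = "\<lambda>g. rank_one (affine_rep F \<psi> g \<phi>)"
  let ?comb = "\<lambda>c x. \<Sum>g\<in>?G. c g * ?v g x"
  have comb: "?comb c \<in> matrices F" for c
  proof -
    have "?v g x = 0" if "x \<notin> Units F \<times> Units F" for g x
      using rank_one_affine_rep_in_matrices[of g \<phi>] that unfolding matrices_def cfuns_def by blast
    thus ?thesis unfolding matrices_def cfuns_def by simp
  qed
  have "\<exists>c. A = ?comb c" if A: "A \<in> matrices F" for A
  proof -
    obtain c where c: "\<forall>g\<in>?G. c_inner (Units F \<times> Units F) (\<lambda>x. A x - ?comb c x) (?v g) = 0"
      using exists_orthogonal_residual[OF finite_affine_group finite_cartesian_product[OF fin_Units fin_Units],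
          of A ?v] ..
    have "measurement F \<psi> \<phi> (\<lambda>x. A x - ?comb c x) = (\<lambda>_. 0)"
    proof
      fix g
      show "measurement F \<psi> \<phi> (\<lambda>x. A x - ?comb c x) g = 0"
      proof (cases "g \<in> ?G")
        case True
        show ?thesis unfolding measurement_eq_c_inner[OF True] by (rule bspec[OF c True])
      qed (simp add: measurement_def)
    qed
    moreover have "(\<lambda>x. A x - ?comb c x) \<in> matrices F"
      using A comb[of c] by (simp add: matrices_def cfuns_def)
    ultimately have "(\<lambda>x. A x - ?comb c x) = (\<lambda>_. 0)" by (rule inj[rotated])
    hence "A = ?comb c" by (simp add: fun_eq_iff)
    thus ?thesis by (rule exI[of _ c])
  qed
  thus ?thesis unfolding matrix_recovery_def using comb by (intro equalityI subsetI) auto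
qed

end

section \<open>Fields of odd prime power order: the lower bound and its sharpness\<close>

locale odd_prime_power_field = field_with_character +
  fixes p h :: nat
  assumes prime: "prime p" and odd: "odd p" and h: "h \<ge> 1" and card_carrier: "card (carrier F) = p ^ h"
begin

lemma p_ge_3: "p \<ge> 3"
  using prime odd prime_ge_2_nat[of p] by (cases "p = 2") auto

text \<open>Multiples of 1 are multiplicative in the multiplier, so the \<open>h\<close>-th power of
  \<open>p 1\<close> is \<open>p^h 1\<close>, which is zero because the additive group has order
  \<open>p^h\<close>. A nonzero \<open>p 1\<close> would be a unit, and so would its powers.\<close>

lemma char_one: "[p] \<cdot> \<one> = \<zero>"
proof (rule ccontr)
  assume ne: "[p] \<cdot> \<one> \<noteq> \<zero>"
  have pow: "[(p ^ n)] \<cdot> \<one> = ([p] \<cdot> \<one>) [^] n" for n :: nat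
  proof (induction n)
    case 0
    show ?case by simp
  next
    case (Suc n)
    have "[(p ^ Suc n)] \<cdot> \<one> = [(p ^ n)] \<cdot> ([p] \<cdot> \<one>)"
      by (simp add: add.nat_pow_pow)
    also have "\<dots> = ([(p ^ n)] \<cdot> \<one>) \<otimes> ([p] \<cdot> \<one>)"
      using add_pow_ldistr[of \<one> "[p] \<cdot> \<one>" "p ^ n"] by simp
    finally show ?case unfolding Suc nat_pow_Suc .
  qed
  have "[(p ^ h)] \<cdot> \<one> = \<zero>"
    using add.pow_order_eq_1[of \<one>] fin card_carrier by (simp add: order_def)
  moreover have "([p] \<cdot> \<one>) [^] h \<in> Units F"
    using ne by (intro Units_pow_closed) (simp add: field_Units)
  ultimately show False unfolding pow by (simp add: field_Units)
qed

lemma char_add_pow: "x \<in> carrier F \<Longrightarrow> [p] \<cdot> x = \<zero>"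
  using add_pow_ldistr[of \<one> x p] char_one by simp

text \<open>The values of \<open>\<psi>\<close> are \<open>p\<close>-th roots of unity whatever
  \<open>h\<close> is; this is why the sine in the bound involves \<open>p\<close> and not
  \<open>q\<close>.\<close>

lemma psi_root: "x \<in> carrier F \<Longrightarrow> \<psi> x ^ p = 1"
  using psi_add_pow[of x p] char_add_pow[of x] psi_zero by simp

definition bound :: real where
  "bound = sqrt (real q) / (s + 1) * sin (pi / (2 * real p))"

lemma bound_eq:
  "bound = sqrt (real (p ^ h)) / (sqrt (real (p ^ h) - 1) + 1) * sin (pi / (2 * real p))"
  by (simp add: bound_def s_def card_carrier)

text \<open>From \<open>1 <= s <= sqrt q\<close> the first factor is at least 1/2, and the sine is
  at least \<open>1 / p\<close>.\<close>

lemma bound_ge: "bound \<ge> 1 / (2 * real p)"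
proof -
  have "s \<le> sqrt (real q)" by (simp add: s_def)
  hence "1 / 2 \<le> sqrt (real q) / (s + 1)" using s_ge_1 by (simp add: field_simps)
  hence "1 / 2 * (1 / real p) \<le> bound"
    unfolding bound_def using sin_pi_over_2n_ge[of p] p_ge_3 s_ge_1 by (intro mult_mono) auto
  thus ?thesis by simp
qed

lemma bound_pos: "bound > 0"
  using p_ge_3 by (intro less_le_trans[OF _ bound_ge]) auto

lemma cancel_twos: "(1 / (2 * (s + 1)))\<^sup>2 * (2 * x)\<^sup>2 = (x / (s + 1))\<^sup>2"
proof -
  have "1 / (2 * (s + 1)) * (2 * x) = x / (s + 1)"
    using s_ge_1 by (simp add: field_simps)
  thus ?thesis by (simp only: power_mult_distrib[symmetric])
qed

text \<open>Splits the constant into Parseval's factor \<open>q\<close>, the normalisation of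
  \<open>phi\<close> and the squared least modulus of \<open>1 + z\<close>, as the estimates on the
  diagonals supply them.\<close>

lemma bound_squared: "bound\<^sup>2 = real q * ((1 / (2 * (s + 1)))\<^sup>2 * (2 * sin (pi / (2 * real p)))\<^sup>2)"
  unfolding bound_def cancel_twos by (simp add: power_mult_distrib power_divide)

text \<open>Off the main diagonal the nonnegative term in the sum of the entries is dropped and
  \<open>sum_cmod_shift_ge\<close> applies; on the main diagonal it is enough to bound the squared
  sine by 1.\<close>

lemma shift_diagonal_bound:
  assumes A: "A \<in> matrices F" and t: "t \<in> carrier F"
  shows "(1 / (2 * (s + 1)))\<^sup>2 * (2 * sin (pi / (2 * real p)))\<^sup>2 *
      (\<Sum>u\<in>carrier F. (cmod (A (u, u \<oplus> t)))\<^sup>2)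
    \<le> (\<Sum>u\<in>Units F. (cmod (diag_corr A (phi F) (inv u) t))\<^sup>2)" (is "?c * ?\<sigma> * ?N \<le> ?D")
proof (cases "t = \<zero>")
  case True
  have "?c * ?\<sigma> * ?N = (sin (pi / (2 * real p)))\<^sup>2 * ?N / (s + 1)\<^sup>2"
    unfolding cancel_twos by (simp add: power_divide)
  also have "\<dots> \<le> 1 * ?N / (s + 1)\<^sup>2"
    by (intro divide_right_mono mult_right_mono sum_nonneg) (auto simp: abs_square_le_1)
  also have "\<dots> \<le> ?D"
    using sum_diag_corr_phi_diagonal_ge[OF A] True s_ge_1 by (simp add: divide_le_eq mult.commute)
  finally show ?thesis .
next
  case False
  have "?\<sigma> * ?N \<le> (\<Sum>u\<in>carrier F. (cmod (A (u, u \<oplus> t) + A (u \<ominus> t, u \<ominus> t \<oplus> t)))\<^sup>2)"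
    by (rule sum_cmod_shift_ge[OF odd psi_root t])
  also have "\<dots> = (\<Sum>u\<in>carrier F. (cmod (A (u, u \<oplus> t) + A (u \<ominus> t, u)))\<^sup>2)"
    using t by (intro sum.cong refl) (simp add: a_minus_def a_assoc l_neg)
  also have "\<dots> \<le> (1 + 4 / s) * (cmod (\<Sum>u\<in>carrier F. A (u, u \<oplus> t)))\<^sup>2 + \<dots>"
    using s_ge_1 by simp
  finally show ?thesis
    unfolding sum_diag_corr_phi[OF A t False] mult.assoc by (rule mult_left_mono) simp
qed

lemma data_norm_ge:
  assumes A: "A \<in> matrices F"
  shows "bound * frobenius_norm F A \<le> data_norm F (measurement F \<psi> (phi F) A)"
proof (rule power2_le_imp_le)
  define c where "c = (1 / (2 * (s + 1)))\<^sup>2 * (2 * sin (pi / (2 * real p)))\<^sup>2"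
  have "(bound * frobenius_norm F A)\<^sup>2 =
      real q * (\<Sum>t\<in>carrier F. c * (\<Sum>u\<in>carrier F. (cmod (A (u, u \<oplus> t)))\<^sup>2))"
    unfolding power_mult_distrib[of bound] frobenius_norm_eq[OF A] bound_squared c_def[symmetric]
    by (simp only: sum_distrib_left mult.assoc)
  also have "\<dots> \<le> real q * (\<Sum>t\<in>carrier F. \<Sum>u\<in>Units F. (cmod (diag_corr A (phi F) (inv u) t))\<^sup>2)"
    unfolding c_def by (intro mult_left_mono sum_mono shift_diagonal_bound[OF A]) auto
  also have "\<dots> = (data_norm F (measurement F \<psi> (phi F) A))\<^sup>2"
    by (rule data_norm_measurement[OF A, symmetric])
  finally show "(bound * frobenius_norm F A)\<^sup>2 \<le> (data_norm F (measurement F \<psi> (phi F) A))\<^sup>2" .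
qed (rule l2_norm_nonneg)

lemma frobenius_norm_le:
  assumes "A \<in> matrices F"
  shows "frobenius_norm F A \<le> 2 * real p * data_norm F (measurement F \<psi> (phi F) A)"
proof -
  have "1 / (2 * real p) * frobenius_norm F A \<le> bound * frobenius_norm F A"
    by (intro mult_right_mono bound_ge l2_norm_nonneg)
  also note data_norm_ge[OF assms]
  finally show ?thesis using p_ge_3 by (simp add: field_simps)
qed

lemma measurement_eq_0D:
  assumes "A \<in> matrices F" "measurement F \<psi> (phi F) A = (\<lambda>_. 0)"
  shows "A = (\<lambda>_. 0)"
  using frobenius_norm_le[OF assms(1)] assms fin_Units
  by (intro l2_norm_le_0D[of "Units F \<times> Units F"]) (auto simp: matrices_def l2_norm_def)

lemma inj_on_measurement: "inj_on (measurement F \<psi> (phi F)) (matrices F)"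
proof
  fix A B assume AB: "A \<in> matrices F" "B \<in> matrices F"
    and eq: "measurement F \<psi> (phi F) A = measurement F \<psi> (phi F) B"
  have "(\<lambda>x. A x - B x) = (\<lambda>_. 0)"
  proof (rule measurement_eq_0D)
    show "(\<lambda>x. A x - B x) \<in> matrices F"
      using AB by (simp add: matrices_def cfuns_def)
    show "measurement F \<psi> (phi F) (\<lambda>x. A x - B x) = (\<lambda>_. 0)"
      using eq by (intro ext) (simp add: measurement_diff)
  qed
  thus "A = B" by (simp add: fun_eq_iff)
qed

text \<open>The extremal matrix is a character, supported off the prime subfield \<open>H\<close>, placed on the
  first shifted diagonal. Removing \<open>H\<close>, a proper subset as \<open>h \<ge> 2\<close>, keeps the support
  shift-invariant and away from \<open>0\<close>.\<close>

lemma exists_extremal_matrix: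
  assumes h2: "h \<ge> 2"
  obtains A where "A \<in> matrices F" "A \<noteq> (\<lambda>_. 0)"
    and "data_norm F (measurement F \<psi> (phi F) A) = bound * frobenius_norm F A"
proof -
  let ?C = "carrier F"
  obtain z where z: "z ^ p = 1" "cmod (1 + z) = 2 * sin (pi / (2 * real p))"
    using exists_odd_root_attaining[OF odd] .
  \<comment> \<open>A value of \<open>\<psi>\<close> other than 1 has every \<open>p\<close>-th root
    of unity among its powers, so some multiple \<open>k\<close> of \<open>x\<close> satisfies
    \<open>\<psi> k = z\<close>.\<close>
  obtain x where x: "x \<in> ?C" "\<psi> x \<noteq> 1"
    using nontrivial by (auto simp: nontrivial_additive_character_def)
  obtain i :: nat where i: "\<psi> x ^ i = z"
    using root_of_unity_prime_generates[OF prime psi_root[OF x(1)] x(2) z(1)] .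
  define k where "k = [i] \<cdot> x"
  have k: "k \<in> ?C" "\<psi> k = z" using x i by (auto simp: k_def psi_add_pow)
  \<comment> \<open>The sine is below 1, so \<open>|1 + z| < 2\<close> and \<open>z\<close> cannot
    be 1.\<close>
  have "sin (pi / (2 * real p)) \<le> pi / (2 * real p)"
    by (intro sin_x_le_x) simp
  also have "\<dots> < 1" using pi_less_4 p_ge_3 by (simp add: field_simps)
  finally have z1: "z \<noteq> 1" using z(2) by auto

  \<comment> \<open>\<open>H\<close> is the prime subfield. Natural multiples of 1 also give the
    negatives, since -1 is the multiple \<open>p - 1\<close> of 1.\<close>
  define H where "H = range (\<lambda>j::nat. [j] \<cdot> \<one>)"
  have HC: "H \<subseteq> ?C" by (auto simp: H_def)
  have plus: "y \<oplus> \<one> \<in> H" if "y \<in> H" for y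
  proof -
    obtain j :: nat where "y = [j] \<cdot> \<one>" using \<open>y \<in> H\<close> unfolding H_def by blast
    hence "y \<oplus> \<one> = [(Suc j)] \<cdot> \<one>" by simp
    thus ?thesis unfolding H_def by blast
  qed
  have minus: "y \<ominus> \<one> \<in> H" if "y \<in> H" for y
  proof -
    obtain j :: nat where j: "y = [j] \<cdot> \<one>" using \<open>y \<in> H\<close> unfolding H_def by blast
    have "[(Suc (p - 1))] \<cdot> \<one> = \<zero>"
      using char_one p_ge_3 by simp
    hence "[(p - 1)] \<cdot> \<one> \<oplus> \<one> = \<zero>" by (simp only: add.nat_pow_Suc)
    hence "[(p - 1)] \<cdot> \<one> = \<ominus> \<one>" by (intro minus_equality[symmetric]) auto
    hence "y \<ominus> \<one> = [(j + (p - 1))] \<cdot> \<one>"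
      unfolding a_minus_def j by (simp add: add.nat_pow_mult[symmetric])
    thus ?thesis unfolding H_def by blast
  qed
  have shift: "u \<ominus> \<one> \<in> H \<longleftrightarrow> u \<in> H" if "u \<in> ?C" for u
  proof -
    have "u \<ominus> \<one> \<oplus> \<one> = u" using that by (simp add: a_minus_def a_assoc l_neg)
    thus ?thesis using plus[of "u \<ominus> \<one>"] minus[of u] by auto
  qed
  have shift': "u \<oplus> \<one> \<in> H \<longleftrightarrow> u \<in> H" if "u \<in> ?C" for u
  proof -
    have "u \<oplus> \<one> \<ominus> \<one> = u" using that by (simp add: a_minus_def a_assoc r_neg)
    thus ?thesis using shift[of "u \<oplus> \<one>"] that by simp
  qed
  have zero: "\<zero> \<in> H" unfolding H_def by (rule range_eqI[of _ _ 0]) simp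
  \<comment> \<open>Reducing the multiplier mod \<open>p\<close> leaves at most \<open>p\<close>
    elements, fewer than \<open>p ^ h\<close> when \<open>h \<ge> 2\<close>.\<close>
  have "H \<subseteq> (\<lambda>j::nat. [j] \<cdot> \<one>) ` {..<p}"
  proof
    fix y assume "y \<in> H"
    then obtain j :: nat where j: "y = [j] \<cdot> \<one>" unfolding H_def by blast
    have "y = [(p * (j div p) + j mod p)] \<cdot> \<one>" by (simp add: j)
    also have "\<dots> = [(p * (j div p))] \<cdot> \<one> \<oplus> [(j mod p)] \<cdot> \<one>"
      by (rule add.nat_pow_mult[symmetric]) simp
    also have "[(p * (j div p))] \<cdot> \<one> = [(j div p)] \<cdot> ([p] \<cdot> \<one>)"
      by (simp add: add.nat_pow_pow)
    finally have "y = [(j mod p)] \<cdot> \<one>" by (simp add: char_one)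
    thus "y \<in> (\<lambda>j::nat. [j] \<cdot> \<one>) ` {..<p}" using p_ge_3 by auto
  qed
  hence "card H \<le> p" using surj_card_le[of "{..<p}" H] by simp
  also have "p < p ^ h" using h2 p_ge_3 power_strict_increasing[of 1 h p] by simp
  finally have "H \<noteq> ?C" using card_carrier by auto
  then obtain y where y: "y \<in> ?C" "y \<notin> H" using HC by auto

  define A where "A = (\<lambda>(m, n). if m \<in> ?C \<and> m \<notin> H \<and> n = m \<oplus> \<one> then \<psi> (k \<otimes> m) else 0)"
  define a where "a u = A (u, u \<oplus> \<one>)" for u
  have a: "a u = (if u \<in> H then 0 else \<psi> (k \<otimes> u))" if "u \<in> ?C" for u
    using that by (simp add: a_def A_def)
  have A_mat: "A \<in> matrices F"
  proof -
    \<comment> \<open>Both \<open>m\<close> and \<open>m + 1\<close> lie outside \<open>H\<close>,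
      which contains 0, so both indices are units.\<close>
    have "m \<noteq> \<zero> \<and> m \<oplus> \<one> \<noteq> \<zero>" if "m \<in> ?C" "m \<notin> H" for m
      using zero shift'[OF that(1)] that by auto
    thus ?thesis by (auto simp: A_def matrices_def cfuns_def field_Units)
  qed
  have "A (y, y \<oplus> \<one>) \<noteq> 0"
    using y k cmod_psi[of "k \<otimes> y"] by (auto simp: A_def)
  hence A_ne: "A \<noteq> (\<lambda>_. 0)" by auto
  have A0: "A (m, m \<oplus> t) = 0" if "m \<in> ?C" "t \<in> ?C" "t \<noteq> \<one>" for m t
    using that by (auto simp: A_def)
  \<comment> \<open>The truncated character is still an eigenvector of the shift because membership
    in \<open>H\<close> is shift-invariant.\<close>
  have a_minus: "a (u \<ominus> \<one>) = cnj z * a u" if "u \<in> ?C" for u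
    using that k by (simp add: a shift psi_mult_diff minus_closed)

  \<comment> \<open>The shift preserves the sum but also multiplies it by \<open>cnj z\<close>,
    which is not 1. So the sum is zero, and the extra energy in \<open>sum_diag_corr_phi\<close>
    disappears.\<close>
  have "(\<Sum>u\<in>?C. a u) = (\<Sum>u\<in>?C. a (u \<ominus> \<one>))"
    by (rule sum_carrier_shift'[symmetric]) simp
  also have "\<dots> = cnj z * (\<Sum>u\<in>?C. a u)"
    by (simp add: a_minus sum_distrib_left)
  finally have S: "(\<Sum>u\<in>?C. a u) = 0" using z1 by auto

  define N where "N = (\<Sum>u\<in>?C. (cmod (a u))\<^sup>2)"
  have "(\<Sum>u\<in>?C. (cmod (A (u, u \<oplus> t)))\<^sup>2) = (if t = \<one> then N else 0)" if "t \<in> ?C" for t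
    using that by (auto simp: N_def a_def A0)
  hence frob: "(frobenius_norm F A)\<^sup>2 = N"
    using fin by (simp add: frobenius_norm_eq[OF A_mat])

  have "(\<Sum>u\<in>?C. (cmod (a u + a (u \<ominus> \<one>)))\<^sup>2) = (\<Sum>u\<in>?C. (cmod (1 + cnj z))\<^sup>2 * (cmod (a u))\<^sup>2)"
  proof (intro sum.cong refl)
    fix u assume "u \<in> ?C"
    hence "a u + a (u \<ominus> \<one>) = (1 + cnj z) * a u" by (simp add: a_minus algebra_simps)
    thus "(cmod (a u + a (u \<ominus> \<one>)))\<^sup>2 = (cmod (1 + cnj z))\<^sup>2 * (cmod (a u))\<^sup>2"
      by (simp only: norm_mult power_mult_distrib)
  qed
  also have "cmod (1 + cnj z) = cmod (1 + z)"
    using complex_mod_cnj[of "1 + z"] by simp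
  finally have "(\<Sum>u\<in>?C. (cmod (a u + a (u \<ominus> \<one>)))\<^sup>2) = (2 * sin (pi / (2 * real p)))\<^sup>2 * N"
    by (simp only: N_def sum_distrib_left z)
  moreover have "(\<Sum>u\<in>?C. (cmod (a u + a (u \<ominus> \<one>)))\<^sup>2) =
      (\<Sum>u\<in>?C. (cmod (A (u, u \<oplus> \<one>) + A (u \<ominus> \<one>, u)))\<^sup>2)"
    unfolding a_def by (intro sum.cong refl) (simp add: a_minus_def a_assoc l_neg)
  ultimately have D1: "(\<Sum>u\<in>Units F. (cmod (diag_corr A (phi F) (inv u) \<one>))\<^sup>2) =
      (1 / (2 * (s + 1)))\<^sup>2 * ((2 * sin (pi / (2 * real p)))\<^sup>2 * N)"
    using S sum_diag_corr_phi[OF A_mat one_closed one_not_zero] unfolding a_def by simp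
  have D0: "(\<Sum>u\<in>Units F. (cmod (diag_corr A (phi F) (inv u) t))\<^sup>2) = 0"
    if "t \<in> ?C" "t \<noteq> \<one>" for t
    using that by (simp add: diag_corr_def A0)
  have "(\<Sum>t\<in>?C. \<Sum>u\<in>Units F. (cmod (diag_corr A (phi F) (inv u) t))\<^sup>2) =
      (\<Sum>t\<in>{\<one>}. \<Sum>u\<in>Units F. (cmod (diag_corr A (phi F) (inv u) t))\<^sup>2)"
    using fin D0 by (intro sum.mono_neutral_right) auto
  hence "(data_norm F (measurement F \<psi> (phi F) A))\<^sup>2 = (bound * frobenius_norm F A)\<^sup>2"
    unfolding data_norm_measurement[OF A_mat] power_mult_distrib[of bound] frob bound_squared
    by (simp add: D1)
  hence "data_norm F (measurement F \<psi> (phi F) A) = bound * frobenius_norm F A"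
    by (rule power2_eq_imp_eq) (use bound_pos in \<open>simp_all add: l2_norm_nonneg\<close>)
  with A_mat A_ne show ?thesis by (rule that)
qed

section \<open>Recovery, the least singular value and uniform stability\<close>

lemma matrix_recovery_phi: "matrix_recovery F \<psi> (phi F)"
  by (rule measurement_injective_imp_recovery) (rule measurement_eq_0D)

text \<open>The extremal matrix puts \<open>bound\<close> into the set of quotients and
  \<open>data_norm_ge\<close> makes it a lower bound, so the \<open>LEAST\<close> is an attained
  minimum. Positivity of the Frobenius norm justifies the division.\<close>

lemma sigma_min_eq:
  assumes "h \<ge> 2"
  shows "sigma_min F \<psi> (phi F) = bound"
proof -
  have pos: "frobenius_norm F A > 0" if "A \<in> matrices F" "A \<noteq> (\<lambda>_. 0)" for A
  proof (rule ccontr)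
    assume "\<not> frobenius_norm F A > 0"
    hence "A = (\<lambda>_. 0)"
      using that fin_Units by (intro l2_norm_le_0D[of "Units F \<times> Units F"]) (auto simp: matrices_def)
    thus False using that by simp
  qed
  show ?thesis unfolding sigma_min_def
  proof (rule Least_equality)
    obtain A where A: "A \<in> matrices F" "A \<noteq> (\<lambda>_. 0)"
      "data_norm F (measurement F \<psi> (phi F) A) = bound * frobenius_norm F A"
      using exists_extremal_matrix[OF assms] .
    show "\<exists>A\<in>matrices F. A \<noteq> (\<lambda>_. 0) \<and>
        bound = data_norm F (measurement F \<psi> (phi F) A) / frobenius_norm F A"
      using A pos[OF A(1,2)] by (intro bexI[of _ A]) auto
  next
    fix r assume "\<exists>A\<in>matrices F. A \<noteq> (\<lambda>_. 0) \<and>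
        r = data_norm F (measurement F \<psi> (phi F) A) / frobenius_norm F A"
    thus "bound \<le> r" using data_norm_ge pos by (auto simp: le_divide_eq)
  qed
qed

lemma stable_recovery_bounds:
  "let q = real (p ^ h); d = q - 1; M = measurement F \<psi> (phi F);
       bound = sqrt q / (sqrt d + 1) * sin (pi / (2 * real p))
   in (\<forall>A\<in>matrices F. data_norm F (M A) \<ge> bound * frobenius_norm F A) \<and>
      inj_on M (matrices F) \<and>
      (\<forall>y\<in>M ` matrices F.
         frobenius_norm F (inv_into (matrices F) M y) \<le> 2 * real p * data_norm F y) \<and>
      (h \<ge> 2 \<longrightarrow> sigma_min F \<psi> (phi F) = bound)"
  unfolding Let_def bound_eq[symmetric]
  using data_norm_ge inj_on_measurement frobenius_norm_le sigma_min_eq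
  by (auto simp: inv_into_f_f[OF inj_on_measurement])

lemma stable_recovery:
  "card (Units F) = p ^ h - 1 \<and> matrix_recovery F \<psi> (phi F) \<and>
    (\<forall>A\<in>matrices F.
      frobenius_norm F A \<le> 2 * real p * data_norm F (measurement F \<psi> (phi F) A))"
  using card_Units card_carrier matrix_recovery_phi frobenius_norm_le by simp

end

text \<open>Finiteness of the carrier follows from its nonzero cardinality, as \<open>card\<close>
  is 0 on infinite sets.\<close>

lemma odd_prime_power_fieldI:
  assumes "prime p" "odd p" "h \<ge> 1" "field F" "card (carrier F) = p ^ h"
    and "nontrivial_additive_character F \<psi>"
  shows "odd_prime_power_field F \<psi> p h"
proof -
  have "card (carrier F) > 0" using assms(5) prime_gt_0_nat[OF assms(1)] by simp
  hence "finite (carrier F)" by (rule card_ge_0_finite)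
  with assms show ?thesis
    by (simp add: odd_prime_power_field_def odd_prime_power_field_axioms_def
        field_with_character_def field_with_character_axioms_def)
qed

theorem theorem6p3:
  fixes p :: nat
  assumes "prime p" and "odd p"
  shows
    "(\<forall>h\<ge>1. \<forall>(F :: 'a ring) \<psi>.
        field F \<longrightarrow> card (carrier F) = p ^ h \<longrightarrow> nontrivial_additive_character F \<psi> \<longrightarrow>
        (let q = real (p ^ h); d = q - 1;
             M = measurement F \<psi> (phi F);
             bound = sqrt q / (sqrt d + 1) * sin (pi / (2 * real p))
         in (\<forall>A\<in>matrices F. data_norm F (M A) \<ge> bound * frobenius_norm F A) \<and>
            inj_on M (matrices F) \<and>
            (\<forall>y\<in>M ` matrices F.
               frobenius_norm F (inv_into (matrices F) M y) \<le> 2 * real p * data_norm F y) \<and>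
            (h \<ge> 2 \<longrightarrow> sigma_min F \<psi> (phi F) = bound)))
     \<and>
     (\<exists>C::real. \<forall>h\<ge>1. \<forall>(F :: 'a ring) \<psi>.
        field F \<longrightarrow> card (carrier F) = p ^ h \<longrightarrow> nontrivial_additive_character F \<psi> \<longrightarrow>
        card (Units F) = p ^ h - 1 \<and>
        matrix_recovery F \<psi> (phi F) \<and>
        (\<forall>A\<in>matrices F. frobenius_norm F A \<le> C * data_norm F (measurement F \<psi> (phi F) A)))"
  \<comment> \<open>Unification with \<open>stable_recovery\<close> instantiates \<open>C\<close> to
    \<open>2 * real p\<close>, which depends on none of \<open>h\<close>, \<open>F\<close> and
    \<open>\<psi>\<close>.\<close>
  by (rule conjI,
      (intro allI impI, rule odd_prime_power_field.stable_recovery_bounds,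
        rule odd_prime_power_fieldI[OF assms], assumption+),
      rule exI, intro allI impI, rule odd_prime_power_field.stable_recovery,
      rule odd_prime_power_fieldI[OF assms], assumption+)

end
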